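(* Let $d\geq 1$, let $X,Y$ be independent random vectors in $\mathbb{R}^d$ with $X,Y\sim\mathcal{N}(0,1,\mathbb{R}^d)$, and let $\xi\in\mathbb{R}^d$ be constant. Then: (i) $\mathrm{E}(\langle X,Y\rangle)=0$ and $\mathrm{V}(\langle X,Y\rangle)=d$; (ii) $\mathrm{E}(\langle X,\xi\rangle)=0$ and $\mathrm{V}(\langle X,\xi\rangle)=\|\xi\|^2$.
   Context: $\mathcal{N}(0,1,\mathbb{R}^d)$ denotes the spherical Gaussian distribution on $\mathbb{R}^d$ with mean zero and unit variance, i.e. with density $(2\pi)^{-d/2}\exp(-\|x\|^2/2)$ with respect to Lebesgue measure. $\langle\cdot,\cdot\rangle$ and $\|\cdot\|$ are the Euclidean scalar product and norm, $\mathrm{E}$ the expectation and $\mathrm{V}$ the variance. *)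

theory Defs
  imports "HOL-Probability.Probability"
begin

text \<open>
  Density of the spherical Gaussian distribution on \<open>real ^ 'n\<close>, the Euclidean space of
  dimension \<open>d = CARD('n)\<close>; every such \<open>d\<close> is at least 1 and every \<open>d \<ge> 1\<close> occurs.
\<close>

definition std_gaussian_density :: "real ^ 'n \<Rightarrow> real" where
  "std_gaussian_density x =
     (2 * pi) powr (- real CARD('n) / 2) * exp (- (norm x)\<^sup>2 / 2)"

end

theory Submission
  imports Defs
begin

text \<open>
  Everything follows from the first two moments of a single standard Gaussian vector:
  \<open>E (X \<bullet> u) = 0\<close> and \<open>E ((X \<bullet> u) * (X \<bullet> v)) = u \<bullet> v\<close>, that is, mean zero and identity
  covariance.  The spherical density is the product over the coordinates of one-dimensional
  standard normal densities, and Lebesgue measure is a product measure, so the integral of a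
  product of functions of single coordinates splits into one-dimensional integrals
  (\<open>has_bochner_integral_lborel_prod\<close>).  For basis vectors the moments are therefore products of
  one-dimensional moments 1, 0, 1 of order 0, 1, 2; the general case is linearity
  (\<open>gaussian_mean\<close>, \<open>gaussian_covariance\<close>).

  Part (ii) is the case \<open>u = v = \<xi>\<close>.  For part (i), write
  \<open>X \<bullet> Y = (\<Sum>b. (X \<bullet> b) * (Y \<bullet> b))\<close>.  By independence each summand has mean \<open>0 * 0\<close>, and the
  expectation of the square is the double sum of \<open>E ((X \<bullet> b) * (X \<bullet> c)) * E ((Y \<bullet> b) * (Y \<bullet> c))\<close>,
  which is 1 for \<open>b = c\<close> and 0 otherwise: the total is the number of basis vectors.
\<close>

text \<open>
  Fubini's theorem for functions with separated variables: \<open>lborel\<close> is the image of the product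
  of one-dimensional Lebesgue measures under the map that reassembles a vector from its coordinates.
\<close>

lemma has_bochner_integral_lborel_prod:
  fixes f :: "'a::euclidean_space \<Rightarrow> real \<Rightarrow> real"
  assumes f: "\<And>b. b \<in> Basis \<Longrightarrow> has_bochner_integral lborel (f b) (I b)"
  shows "has_bochner_integral lborel (\<lambda>x::'a. \<Prod>b\<in>Basis. f b (x \<bullet> b)) (\<Prod>b\<in>Basis. I b)"
proof -
  interpret product_sigma_finite "\<lambda>_::'a. lborel::real measure" ..
  have int: "integrable lborel (f b)" if "b \<in> Basis" for b
    using f[OF that] by (simp add: has_bochner_integral_iff)
  have [measurable]: "f b \<in> borel_measurable borel" if "b \<in> Basis" for b
    using int[OF that] by (auto dest: borel_measurable_integrable)
  have *: "(\<Prod>b\<in>Basis. f b ((\<Sum>c\<in>Basis. y c *\<^sub>R c) \<bullet> b)) = (\<Prod>b\<in>(Basis::'a set). f b (y b))" for y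
    by (intro prod.cong) auto
  have "has_bochner_integral (\<Pi>\<^sub>M b\<in>(Basis::'a set). lborel)
          (\<lambda>y. \<Prod>b\<in>Basis. f b (y b)) (\<Prod>b\<in>Basis. I b)"
    using f by (auto simp: has_bochner_integral_iff product_integrable_prod product_integral_prod int
        intro!: prod.cong)
  then have "has_bochner_integral
      (distr (\<Pi>\<^sub>M b\<in>(Basis::'a set). lborel) borel (\<lambda>y. \<Sum>c\<in>Basis. y c *\<^sub>R c))
      (\<lambda>x. \<Prod>b\<in>Basis. f b (x \<bullet> b)) (\<Prod>b\<in>Basis. I b)"
    by (intro has_bochner_integral_distr) (auto simp: *)
  then show ?thesis
    by (simp add: lborel_eq[symmetric])
qed

lemma std_gaussian_density_eq_prod:
  fixes x :: "real ^ 'n"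
  shows "std_gaussian_density x = (\<Prod>b\<in>Basis. std_normal_density (x \<bullet> b))"
proof -
  have "(2 * pi) powr (- real CARD('n) / 2) = ((2 * pi) powr (- (1 / 2))) powr real CARD('n)"
    by (simp add: powr_powr)
  also have "(2 * pi) powr (- (1 / 2)) = 1 / sqrt (2 * pi)"
    using powr_minus_divide[of "2 * pi" "1 / 2"] powr_half_sqrt[of "2 * pi"] by simp
  also have "(1 / sqrt (2 * pi)) powr real CARD('n) = (1 / sqrt (2 * pi)) ^ CARD('n)"
    by (rule powr_realpow) simp
  finally have const: "(2 * pi) powr (- real CARD('n) / 2) = (1 / sqrt (2 * pi)) ^ CARD('n)" .
  have "(norm x)\<^sup>2 = (\<Sum>b\<in>Basis. (x \<bullet> b)\<^sup>2)"
    unfolding power2_norm_eq_inner by (subst euclidean_inner) (simp only: power2_eq_square)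
  then have "- (norm x)\<^sup>2 / 2 = (\<Sum>b\<in>Basis. - (x \<bullet> b)\<^sup>2 / 2)"
    by (simp add: sum_negf sum_divide_distrib)
  then have "exp (- (norm x)\<^sup>2 / 2) = (\<Prod>b\<in>Basis. exp (- (x \<bullet> b)\<^sup>2 / 2))"
    by (simp only: exp_sum[OF finite_Basis])
  then show ?thesis
    by (simp only: std_gaussian_density_def std_normal_density_def prod.distrib const
        prod_constant DIM_cart DIM_real mult_1_right)
qed

text \<open>
  One formula covers the values 1, 0, 1 of the moments of order 0, 1, 2; it stops at order 2
  because the fourth moment is already 3.
\<close>

lemma std_normal_low_moments:
  assumes "k \<le> 2"
  shows "has_bochner_integral lborel (\<lambda>t. std_normal_density t * t ^ k) (if even k then 1 else 0)"
proof -
  consider "k = 0" | "k = 1" | "k = 2"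
    using assms by linarith
  then show ?thesis
    using std_normal_moment_even[of 0] std_normal_moment_odd[of 0] std_normal_moment_even[of 1]
    by cases simp_all
qed

text \<open>
  A monomial in the coordinates is encoded by its exponents \<open>k b\<close>, so that the means and the
  covariances of the coordinates come from a single application of the product formula.
\<close>

lemma gaussian_monomial_moment:
  fixes X :: "'w \<Rightarrow> real ^ 'n"
  assumes X: "distributed M lborel X (\<lambda>x. ennreal (std_gaussian_density x))"
    and k: "\<And>b. b \<in> Basis \<Longrightarrow> k b \<le> 2"
  shows "has_bochner_integral M (\<lambda>\<omega>. \<Prod>b\<in>Basis. (X \<omega> \<bullet> b) ^ k b)
           (\<Prod>b\<in>(Basis :: (real ^ 'n) set). if even (k b) then 1 else 0)"
proof -
  have nonneg: "0 \<le> std_gaussian_density x" for x :: "real ^ 'n"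
    by (simp add: std_gaussian_density_def)
  have [measurable]: "(\<lambda>x::real ^ 'n. \<Prod>b\<in>Basis. (x \<bullet> b) ^ k b) \<in> borel_measurable lborel"
    by measurable
  have "has_bochner_integral lborel
          (\<lambda>x::real ^ 'n. \<Prod>b\<in>Basis. std_normal_density (x \<bullet> b) * (x \<bullet> b) ^ k b)
          (\<Prod>b\<in>(Basis :: (real ^ 'n) set). if even (k b) then 1 else 0)"
    using k by (intro has_bochner_integral_lborel_prod std_normal_low_moments)
  then have "has_bochner_integral lborel
          (\<lambda>x::real ^ 'n. std_gaussian_density x * (\<Prod>b\<in>Basis. (x \<bullet> b) ^ k b))
          (\<Prod>b\<in>(Basis :: (real ^ 'n) set). if even (k b) then 1 else 0)"
    by (simp only: std_gaussian_density_eq_prod prod.distrib)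
  then show ?thesis
    using distributed_integrable[OF X, of "\<lambda>x. \<Prod>b\<in>Basis. (x \<bullet> b) ^ k b"]
      distributed_integral[OF X, of "\<lambda>x. \<Prod>b\<in>Basis. (x \<bullet> b) ^ k b"] nonneg
    by (simp add: has_bochner_integral_iff)
qed

lemma gaussian_mean:
  fixes X :: "'w \<Rightarrow> real ^ 'n"
  assumes X: "distributed M lborel X (\<lambda>x. ennreal (std_gaussian_density x))"
  shows "has_bochner_integral M (\<lambda>\<omega>. X \<omega> \<bullet> u) 0"
proof -
  have coord: "has_bochner_integral M (\<lambda>\<omega>. X \<omega> \<bullet> b) 0" if b: "b \<in> Basis" for b
  proof -
    define k where "k c = (if c = b then 1 else 0 :: nat)" for c :: "real ^ 'n"
    have k_le: "k c \<le> 2" for c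
      by (simp add: k_def)
    have "(\<Prod>c\<in>Basis. (X \<omega> \<bullet> c) ^ k c) = X \<omega> \<bullet> b" for \<omega>
      using b by (simp only: k_def if_distrib[of "power _"] power_one_right power_0 prod.delta
          finite_Basis if_True)
    moreover have "(\<Prod>c\<in>(Basis :: (real ^ 'n) set). if even (k c) then 1 else 0 :: real) = 0"
      using b by (auto simp: k_def)
    ultimately show ?thesis
      using gaussian_monomial_moment[OF X, of k] by (simp only: k_le)
  qed
  have "has_bochner_integral M (\<lambda>\<omega>. \<Sum>b\<in>Basis. (X \<omega> \<bullet> b) * (u \<bullet> b)) (\<Sum>b\<in>Basis. 0 * (u \<bullet> b))"
    by (intro has_bochner_integral_sum has_bochner_integral_mult_left coord)
  then show ?thesis
    by (simp add: euclidean_inner[of _ u])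
qed

text \<open>
  For distinct basis vectors the monomial has an odd exponent, so its expectation vanishes; for
  equal ones all exponents are even.  This suffices, since both sides are bilinear in \<open>u\<close> and \<open>v\<close>.
\<close>

lemma gaussian_covariance:
  fixes X :: "'w \<Rightarrow> real ^ 'n"
  assumes X: "distributed M lborel X (\<lambda>x. ennreal (std_gaussian_density x))"
  shows "has_bochner_integral M (\<lambda>\<omega>. (X \<omega> \<bullet> u) * (X \<omega> \<bullet> v)) (u \<bullet> v)"
proof -
  have coord: "has_bochner_integral M (\<lambda>\<omega>. (X \<omega> \<bullet> b) * (X \<omega> \<bullet> c)) (b \<bullet> c)"
    if b: "b \<in> Basis" and c: "c \<in> Basis" for b c
  proof -
    \<comment> \<open>A sum of two indicators, so that \<open>b = c\<close> yields the exponent 2.\<close>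
    define k where "k a = (if a = b then 1 else 0) + (if a = c then 1 else 0 :: nat)"
      for a :: "real ^ 'n"
    have k_le: "k a \<le> 2" for a
      by (simp add: k_def)
    have "(\<Prod>a\<in>Basis. (X \<omega> \<bullet> a) ^ k a) = (X \<omega> \<bullet> b) * (X \<omega> \<bullet> c)" for \<omega>
      using b c by (simp only: k_def power_add prod.distrib if_distrib[of "power _"] power_one_right
          power_0 prod.delta finite_Basis if_True)
    moreover have "(\<Prod>a\<in>(Basis :: (real ^ 'n) set). if even (k a) then 1 else 0 :: real) = b \<bullet> c"
      using b c by (cases "b = c") (auto simp: k_def inner_Basis intro!: prod.neutral)
    ultimately show ?thesis
      using gaussian_monomial_moment[OF X, of k] by (simp only: k_le)
  qed
  have "has_bochner_integral M
      (\<lambda>\<omega>. \<Sum>b\<in>Basis. \<Sum>c\<in>Basis. ((X \<omega> \<bullet> b) * (X \<omega> \<bullet> c)) * ((u \<bullet> b) * (v \<bullet> c)))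
      (\<Sum>b\<in>Basis. \<Sum>c\<in>Basis. (b \<bullet> c) * ((u \<bullet> b) * (v \<bullet> c)))"
    by (intro has_bochner_integral_sum has_bochner_integral_mult_left coord)
  moreover have "(\<Sum>b\<in>Basis. \<Sum>c\<in>Basis. ((X \<omega> \<bullet> b) * (X \<omega> \<bullet> c)) * ((u \<bullet> b) * (v \<bullet> c)))
      = (X \<omega> \<bullet> u) * (X \<omega> \<bullet> v)" for \<omega>
    by (simp add: euclidean_inner[of _ u] euclidean_inner[of _ v] sum_product ac_simps)
  moreover have "(\<Sum>b\<in>Basis. \<Sum>c\<in>Basis. (b \<bullet> c) * ((u \<bullet> b) * (v \<bullet> c))) = u \<bullet> v"
    by (simp add: euclidean_inner[of u v] inner_Basis if_distrib if_distribR cong: if_cong)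
  ultimately show ?thesis
    by simp
qed

text \<open>
  Real functions of \<open>X\<close> and \<open>Y\<close> inherit independence; the intended ones are single coordinates of
  a random vector, for means, and products of two coordinates, for second moments.
\<close>

lemma (in prob_space) has_bochner_integral_indep_mult:
  fixes f g :: "'b::topological_space \<Rightarrow> real"
  assumes indep: "indep_var borel X borel Y"
    and meas: "f \<in> borel_measurable borel" "g \<in> borel_measurable borel"
    and f: "has_bochner_integral M (\<lambda>\<omega>. f (X \<omega>)) p"
    and g: "has_bochner_integral M (\<lambda>\<omega>. g (Y \<omega>)) q"
  shows "has_bochner_integral M (\<lambda>\<omega>. f (X \<omega>) * g (Y \<omega>)) (p * q)"
proof -
  have *: "indep_var borel (\<lambda>\<omega>. f (X \<omega>)) borel (\<lambda>\<omega>. g (Y \<omega>))"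
    using indep_var_compose[OF indep meas] by (simp add: comp_def)
  then show ?thesis
    using indep_var_integrable[OF *] indep_var_lebesgue_integral[OF *] f g
    by (simp add: has_bochner_integral_iff)
qed

theorem theorem1p4:
  fixes M :: "'w measure"
    and X Y :: "'w \<Rightarrow> real ^ 'n"
    and \<xi> :: "real ^ 'n"
  assumes "prob_space M"
    and "distributed M lborel X (\<lambda>x. ennreal (std_gaussian_density x))"
    and "distributed M lborel Y (\<lambda>x. ennreal (std_gaussian_density x))"
    and "prob_space.indep_var M borel X borel Y"
  shows "(prob_space.expectation M (\<lambda>\<omega>. X \<omega> \<bullet> Y \<omega>) = 0 \<and>
          prob_space.variance M (\<lambda>\<omega>. X \<omega> \<bullet> Y \<omega>) = real CARD('n)) \<and>
         (prob_space.expectation M (\<lambda>\<omega>. X \<omega> \<bullet> \<xi>) = 0 \<and>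
          prob_space.variance M (\<lambda>\<omega>. X \<omega> \<bullet> \<xi>) = (norm \<xi>)\<^sup>2)"
proof -
  interpret prob_space M by fact
  note X = assms(2) and Y = assms(3) and indep = assms(4)

  have "has_bochner_integral M (\<lambda>\<omega>. \<Sum>b\<in>Basis. (X \<omega> \<bullet> b) * (Y \<omega> \<bullet> b))
      (\<Sum>b\<in>(Basis :: (real ^ 'n) set). 0 * 0)"
    by (intro has_bochner_integral_sum has_bochner_integral_indep_mult[OF indep]
        gaussian_mean[OF X] gaussian_mean[OF Y]) measurable
  then have mean_XY: "expectation (\<lambda>\<omega>. X \<omega> \<bullet> Y \<omega>) = 0"
    by (simp add: has_bochner_integral_iff euclidean_inner[of "X _" "Y _"])

  have "has_bochner_integral M
      (\<lambda>\<omega>. \<Sum>b\<in>Basis. \<Sum>c\<in>Basis. ((X \<omega> \<bullet> b) * (X \<omega> \<bullet> c)) * ((Y \<omega> \<bullet> b) * (Y \<omega> \<bullet> c)))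
      (\<Sum>b\<in>(Basis :: (real ^ 'n) set). \<Sum>c\<in>Basis. (b \<bullet> c) * (b \<bullet> c))"
    by (intro has_bochner_integral_sum
        has_bochner_integral_indep_mult[OF indep, where f = "\<lambda>x. (x \<bullet> _) * (x \<bullet> _)"
          and g = "\<lambda>x. (x \<bullet> _) * (x \<bullet> _)"]
        gaussian_covariance[OF X] gaussian_covariance[OF Y]) measurable
  moreover have "(\<Sum>b\<in>Basis. \<Sum>c\<in>Basis. ((X \<omega> \<bullet> b) * (X \<omega> \<bullet> c)) * ((Y \<omega> \<bullet> b) * (Y \<omega> \<bullet> c)))
      = (X \<omega> \<bullet> Y \<omega>)\<^sup>2" for \<omega>
    by (simp add: euclidean_inner[of "X \<omega>" "Y \<omega>"] power2_eq_square sum_product ac_simps)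
  moreover have "(\<Sum>b\<in>(Basis :: (real ^ 'n) set). \<Sum>c\<in>Basis. (b \<bullet> c) * (b \<bullet> c)) = real CARD('n)"
    by (simp add: inner_Basis if_distrib if_distribR cong: if_cong)
  ultimately have "expectation (\<lambda>\<omega>. (X \<omega> \<bullet> Y \<omega>)\<^sup>2) = real CARD('n)"
    by (simp add: has_bochner_integral_iff)
  then have var_XY: "variance (\<lambda>\<omega>. X \<omega> \<bullet> Y \<omega>) = real CARD('n)"
    by (simp add: mean_XY)

  have mean_X: "expectation (\<lambda>\<omega>. X \<omega> \<bullet> \<xi>) = 0"
    using gaussian_mean[OF X] by (rule has_bochner_integral_integral_eq)
  have "variance (\<lambda>\<omega>. X \<omega> \<bullet> \<xi>) = (norm \<xi>)\<^sup>2"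
    using has_bochner_integral_integral_eq[OF gaussian_covariance[OF X, of \<xi> \<xi>]]
    by (simp add: mean_X power2_norm_eq_inner flip: power2_eq_square)
  with mean_XY var_XY mean_X show ?thesis
    by blast
qed

end
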